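(* Let $A$ be a point-fibred attractor of an iterated function system $\mathcal{F}$ on a complete metric space $\mathbb{X}$, with basin $B$ and fast basin $\widehat{B}$. Then $B\subseteq\widehat{B}$ if and only if $A^\circ\neq\varnothing$. Moreover, if $\mathcal{F}$ is contractive and $A^\circ\neq\varnothing$, then $B=\widehat{B}=\mathbb{X}$.
   Context: An iterated function system (IFS) $\mathcal{F}=\{\mathbb{X};\,f_1,\dots,f_N\}$ is a complete metric space $(\mathbb{X},d_{\mathbb{X}})$ together with finitely many homeomorphisms $f_n:\mathbb{X}\to\mathbb{X}$ of $\mathbb{X}$ onto itself. It is contractive if there is $\lambda\in[0,1)$ with $d_{\mathbb{X}}(f_n(x),f_n(y))\leq\lambda d_{\mathbb{X}}(x,y)$ for all $n$ and all $x,y\in\mathbb{X}$. $H$ is the set of nonempty compact subsets of $\mathbb{X}$ with the Hausdorff metric. For $S\subset\mathbb{X}$, $F(S)=\bigcup_{n=1}^N f_n(S)$, and $F^k$ is the $k$-fold iterate of $F$. An attractor of $\mathcal{F}$ is a set $A\in H$ with $F(A)=A$ for which there is an open set $U\supset A$ such that $F^k(C)\to A$ in the Hausdorff metric for every $C\in H$ with $C\subset U$. The union of all such open sets $U$ is the basin $B=B(A)$ of $A$ (the defining property also holds with $U=B(A)$). With $\mathbb{I}_+=\{1,\dots,N\}^{\infty}$ (infinite words) and $f_{\iota|k}=f_{\iota_1}\circ\cdots\circ f_{\iota_k}$, the attractor $A$ is point-fibred if for every $\iota\in\mathbb{I}_+$ the limit $\lim_{k\to\infty}f_{\iota|k}(C)$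 exists in the Hausdorff metric for all $C\in H$ with $C\subset B(A)$, is a singleton subset of $A$, and is independent of $C$. The fast basin of $A$ is $\widehat{B}=\{x\in\mathbb{X}: F^K(\{x\})\cap A\neq\varnothing \text{ for some } K\in\mathbb{N}\}$, $\mathbb{N}=\{1,2,\dots\}$. $A^\circ$ is the interior of $A$ in $\mathbb{X}$. *)

theory Defs
  imports "HOL-Analysis.Analysis"
begin

text \<open>
  The ambient space is a type of class \<open>complete_space\<close>. An iterated function system is given by
  \<open>N\<close> and maps \<open>f 1, \<dots>, f N\<close>; the values of \<open>f\<close> outside \<open>{1..N}\<close> are irrelevant.
\<close>

definition IFS :: "nat \<Rightarrow> (nat \<Rightarrow> 'a::complete_space \<Rightarrow> 'a) \<Rightarrow> bool" where
  "IFS N f \<longleftrightarrow> 1 \<le> N \<and> (\<forall>n\<in>{1..N}. \<exists>g. homeomorphism UNIV UNIV (f n) g)"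

definition contractive :: "nat \<Rightarrow> (nat \<Rightarrow> 'a::complete_space \<Rightarrow> 'a) \<Rightarrow> bool" where
  "contractive N f \<longleftrightarrow>
     (\<exists>r. 0 \<le> r \<and> r < 1 \<and> (\<forall>n\<in>{1..N}. \<forall>x y. dist (f n x) (f n y) \<le> r * dist x y))"

definition hyperspace :: "'a::metric_space set set" where
  "hyperspace = {C. compact C \<and> C \<noteq> {}}"

text \<open>The suprema are those of bounded nonempty sets of reals when \<open>S\<close> and \<open>T\<close> are in
  \<open>hyperspace\<close>; elsewhere the value is not meaningful.\<close>

definition hausdorff_dist :: "'a::metric_space set \<Rightarrow> 'a set \<Rightarrow> real" where
  "hausdorff_dist S T = max (SUP x\<in>S. infdist x T) (SUP y\<in>T. infdist y S)"

definition hausdorff_tendsto :: "(nat \<Rightarrow> 'a::metric_space set) \<Rightarrow> 'a set \<Rightarrow> bool" where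
  "hausdorff_tendsto S L \<longleftrightarrow> (\<lambda>k. hausdorff_dist (S k) L) \<longlonglongrightarrow> 0"

definition hutchinson :: "nat \<Rightarrow> (nat \<Rightarrow> 'a \<Rightarrow> 'a) \<Rightarrow> 'a set \<Rightarrow> 'a set" where
  "hutchinson N f S = (\<Union>n\<in>{1..N}. f n ` S)"

definition attracting_nbhd ::
    "nat \<Rightarrow> (nat \<Rightarrow> 'a::complete_space \<Rightarrow> 'a) \<Rightarrow> 'a set \<Rightarrow> 'a set \<Rightarrow> bool" where
  "attracting_nbhd N f A U \<longleftrightarrow> open U \<and> A \<subseteq> U \<and>
     (\<forall>C\<in>hyperspace. C \<subseteq> U \<longrightarrow> hausdorff_tendsto (\<lambda>k. (hutchinson N f ^^ k) C) A)"

definition attractor :: "nat \<Rightarrow> (nat \<Rightarrow> 'a::complete_space \<Rightarrow> 'a) \<Rightarrow> 'a set \<Rightarrow> bool" where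
  "attractor N f A \<longleftrightarrow>
     A \<in> hyperspace \<and> hutchinson N f A = A \<and> (\<exists>U. attracting_nbhd N f A U)"

definition basin :: "nat \<Rightarrow> (nat \<Rightarrow> 'a::complete_space \<Rightarrow> 'a) \<Rightarrow> 'a set \<Rightarrow> 'a set" where
  "basin N f A = \<Union>{U. attracting_nbhd N f A U}"

text \<open>\<open>word_map f \<iota> k\<close> is \<open>f (\<iota> 1) \<circ> \<dots> \<circ> f (\<iota> k)\<close>. Letters of an infinite word are indexed
  from 1, so \<open>\<iota> 0\<close> plays no role.\<close>

primrec word_map :: "(nat \<Rightarrow> 'a \<Rightarrow> 'a) \<Rightarrow> (nat \<Rightarrow> nat) \<Rightarrow> nat \<Rightarrow> 'a \<Rightarrow> 'a" where
  "word_map f \<iota> 0 = id"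
| "word_map f \<iota> (Suc k) = word_map f \<iota> k \<circ> f (\<iota> (Suc k))"

text \<open>Independence of the limit from \<open>C\<close> is expressed by choosing \<open>a\<close> before \<open>C\<close>.\<close>

definition point_fibred :: "nat \<Rightarrow> (nat \<Rightarrow> 'a::complete_space \<Rightarrow> 'a) \<Rightarrow> 'a set \<Rightarrow> bool" where
  "point_fibred N f A \<longleftrightarrow>
     (\<forall>\<iota> \<in> {1..} \<rightarrow> {1..N}. \<exists>a\<in>A. \<forall>C\<in>hyperspace. C \<subseteq> basin N f A \<longrightarrow>
        hausdorff_tendsto (\<lambda>k. word_map f \<iota> k ` C) {a})"

definition fast_basin :: "nat \<Rightarrow> (nat \<Rightarrow> 'a \<Rightarrow> 'a) \<Rightarrow> 'a set \<Rightarrow> 'a set" where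
  "fast_basin N f A = {x. \<exists>K\<ge>1. (hutchinson N f ^^ K) {x} \<inter> A \<noteq> {}}"

end

(* The fast basin is the union over K \<ge> 1 of the sets of points that some composition of K of the
   maps sends into A. Because the maps are homeomorphisms, these sets are closed, and all of them
   have empty interior when A does; the Baire category theorem then keeps the nonempty open basin
   out of the fast basin. Conversely, the orbit of a point of the basin comes arbitrarily close to
   an interior point of A, hence enters A. For a contractive system, F shrinks Hausdorff distances
   to the fixed set A, so every compact set is attracted and the basin is the whole space. *)

theory Submission
  imports Defs
begin

text \<open>Compactness of \<open>T\<close> bounds the values \<open>infdist y S\<close>, so the
  supremum over \<open>T\<close> is a genuine least upper bound.\<close>

lemma infdist_le_hausdorff_dist:
  assumes "compact T" "y \<in> T"
  shows "infdist y S \<le> hausdorff_dist S T"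
proof -
  have "compact ((\<lambda>y. infdist y S) ` T)"
    using assms(1) by (intro compact_continuous_image continuous_intros)
  then have "bdd_above ((\<lambda>y. infdist y S) ` T)"
    by (intro bounded_imp_bdd_above compact_imp_bounded)
  then have "infdist y S \<le> (SUP y\<in>T. infdist y S)"
    using assms(2) by (rule cSUP_upper2) simp
  then show ?thesis
    by (simp add: hausdorff_dist_def)
qed

lemma hausdorff_dist_le:
  assumes "S \<noteq> {}" "T \<noteq> {}"
    and "\<forall>x\<in>S. \<exists>y\<in>T. dist x y \<le> e" "\<forall>y\<in>T. \<exists>x\<in>S. dist y x \<le> e"
  shows "hausdorff_dist S T \<le> e"
  unfolding hausdorff_dist_def
proof (intro max.boundedI cSUP_least)
  show "infdist x T \<le> e" if "x \<in> S" for x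
    using assms(3) that infdist_le2 by blast
  show "infdist y S \<le> e" if "y \<in> T" for y
    using assms(4) that infdist_le2 by blast
qed (use assms in simp_all)

text \<open>A homeomorphism of the whole space is an open map, so it sends the interior of the
  preimage onto an open subset of \<open>T\<close>.\<close>

lemma homeomorphism_UNIV_interior_vimage_eq_empty:
  assumes "homeomorphism UNIV UNIV h g" "interior T = {}"
  shows "interior (h -` T) = {}"
proof -
  have "open (h ` interior (h -` T))"
    using homeomorphism_imp_open_map[OF assms(1), of "interior (h -` T)"] by simp
  moreover have "h ` interior (h -` T) \<subseteq> T"
    using interior_subset by fastforce
  ultimately have "h ` interior (h -` T) \<subseteq> interior T"
    by (rule interior_maximal[rotated])
  then show ?thesis
    using assms(2) by simp
qed

lemma interior_finite_Union_eq_empty: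
  assumes "finite I" "\<And>i. i \<in> I \<Longrightarrow> closed (S i) \<and> interior (S i) = {}"
  shows "interior (\<Union>i\<in>I. S i) = {}"
  using assms by (induction I) (simp_all add: interior_closed_Un_empty_interior closed_UN)

text \<open>This is the Baire category theorem, available because the space is complete.\<close>

lemma interior_countable_Union_eq_empty:
  fixes S :: "nat \<Rightarrow> 'a::complete_space set"
  assumes "\<And>k. closed (S k) \<and> interior (S k) = {}"
  shows "interior (\<Union>k. S k) = {}"
proof -
  have "euclidean interior_of (\<Union>(range S)) = {}"
    using assms by (intro Baire_category_alt) (auto simp: completely_metrizable_space_euclidean)
  then show ?thesis
    by simp
qed

lemma hutchinson_funpow_nonempty:
  assumes "1 \<le> N" "S \<noteq> {}"
  shows "(hutchinson N f ^^ k) S \<noteq> {}"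
  using assms by (induction k) (auto simp: hutchinson_def)

text \<open>The adjoint of \<open>hutchinson\<close> for the relation of meeting: the image of
  \<open>S\<close> meets \<open>T\<close> exactly when \<open>S\<close> meets this set. It trades
  forward orbits for iterated preimages of a fixed target.\<close>

definition hutchinson_vimage :: "nat \<Rightarrow> (nat \<Rightarrow> 'a \<Rightarrow> 'a) \<Rightarrow> 'a set \<Rightarrow> 'a set" where
  "hutchinson_vimage N f T = (\<Union>n\<in>{1..N}. f n -` T)"

text \<open>The outermost application of \<open>hutchinson\<close> is moved across to
  \<open>T\<close>, where it becomes the innermost preimage step. The target changes, so the
  induction needs \<open>T\<close> arbitrary.\<close>

lemma hutchinson_funpow_meets_iff:
  "(hutchinson N f ^^ k) S \<inter> T \<noteq> {} \<longleftrightarrow> S \<inter> (hutchinson_vimage N f ^^ k) T \<noteq> {}"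
proof (induction k arbitrary: T)
  case (Suc k)
  have "(hutchinson N f ^^ Suc k) S \<inter> T \<noteq> {} \<longleftrightarrow>
      (hutchinson N f ^^ k) S \<inter> hutchinson_vimage N f T \<noteq> {}"
    unfolding funpow.simps comp_apply hutchinson_def hutchinson_vimage_def by blast
  also have "\<dots> \<longleftrightarrow> S \<inter> (hutchinson_vimage N f ^^ Suc k) T \<noteq> {}"
    unfolding Suc.IH funpow_Suc_right by simp
  finally show ?case .
qed simp

text \<open>The union also contains the term \<open>A\<close> at \<open>k = 0\<close>, so only an
  inclusion is claimed; that is enough for bounding the interior.\<close>

lemma fast_basin_subset:
  "fast_basin N f A \<subseteq> (\<Union>k. (hutchinson_vimage N f ^^ k) A)"
  unfolding fast_basin_def hutchinson_funpow_meets_iff by auto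

text \<open>Closedness is carried through the induction because a finite union of sets with empty
  interior can have interior points unless the sets are closed.\<close>

lemma hutchinson_vimage_funpow_closed_empty_interior:
  assumes "IFS N f" "closed A" "interior A = {}"
  shows "closed ((hutchinson_vimage N f ^^ k) A) \<and> interior ((hutchinson_vimage N f ^^ k) A) = {}"
proof (induction k)
  case (Suc k)
  let ?T = "(hutchinson_vimage N f ^^ k) A"
  have T: "closed (f n -` ?T)" "interior (f n -` ?T) = {}" if n: "n \<in> {1..N}" for n
  proof -
    obtain g where g: "homeomorphism UNIV UNIV (f n) g"
      using assms(1) n by (auto simp only: IFS_def)
    show "closed (f n -` ?T)"
      using Suc homeomorphism_cont1[OF g] by (intro closed_vimage) simp_all
    show "interior (f n -` ?T) = {}"
      using Suc by (intro homeomorphism_UNIV_interior_vimage_eq_empty[OF g]) simp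
  qed
  have "(hutchinson_vimage N f ^^ Suc k) A = (\<Union>n\<in>{1..N}. f n -` ?T)"
    by (simp add: hutchinson_vimage_def)
  moreover have "closed (\<Union>n\<in>{1..N}. f n -` ?T)"
    using T(1) by (intro closed_UN) auto
  moreover have "interior (\<Union>n\<in>{1..N}. f n -` ?T) = {}"
    by (intro interior_finite_Union_eq_empty) (simp_all only: T finite_atLeastAtMost)
  ultimately show ?case
    by (simp only:)
qed (use assms in simp)

lemma interior_fast_basin_eq_empty:
  assumes "IFS N f" "closed A" "interior A = {}"
  shows "interior (fast_basin N f A) = {}"
proof -
  have "interior (\<Union>k. (hutchinson_vimage N f ^^ k) A) = {}"
    by (rule interior_countable_Union_eq_empty)
      (rule hutchinson_vimage_funpow_closed_empty_interior[OF assms])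
  then show ?thesis
    using interior_mono[OF fast_basin_subset[of N f A]] by blast
qed

lemma open_basin: "open (basin N f A)"
  unfolding basin_def attracting_nbhd_def by blast

lemma attractor_subset_basin: "attractor N f A \<Longrightarrow> A \<subseteq> basin N f A"
  unfolding attractor_def basin_def attracting_nbhd_def by blast

lemma interior_nonempty_if_basin_subset_fast_basin:
  assumes "IFS N f" "attractor N f A" "basin N f A \<subseteq> fast_basin N f A"
  shows "interior A \<noteq> {}"
proof
  assume "interior A = {}"
  moreover have "closed A"
    using assms(2) compact_imp_closed unfolding attractor_def hyperspace_def by blast
  ultimately have "interior (fast_basin N f A) = {}"
    using assms(1) by (intro interior_fast_basin_eq_empty)
  then have "basin N f A = {}"
    using interior_maximal[OF assms(3) open_basin] by simp
  then show False
    using assms(2) attractor_subset_basin[OF assms(2)] unfolding attractor_def hyperspace_def by blast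
qed

lemma basin_subset_fast_basin:
  assumes "1 \<le> N" "compact A" "interior A \<noteq> {}"
  shows "basin N f A \<subseteq> fast_basin N f A"
proof
  fix x assume "x \<in> basin N f A"
  then obtain U where U: "attracting_nbhd N f A U" "x \<in> U"
    by (auto simp: basin_def)
  let ?S = "\<lambda>k. (hutchinson N f ^^ k) {x}"
  have lim: "(\<lambda>k. hausdorff_dist (?S k) A) \<longlonglongrightarrow> 0"
  proof -
    have "{x} \<in> hyperspace" "{x} \<subseteq> U"
      using U(2) by (simp_all add: hyperspace_def)
    then show ?thesis
      using U(1) unfolding attracting_nbhd_def hausdorff_tendsto_def by blast
  qed
  obtain a where "a \<in> interior A"
    using assms(3) by blast
  then obtain e where e: "e > 0" "ball a e \<subseteq> A"
    unfolding mem_interior by blast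
  \<comment> \<open>The bound \<open>1 \<le> k\<close> is requested because
    \<open>fast_basin\<close> counts only positive iterates.\<close>
  have "\<forall>\<^sub>F k in sequentially. hausdorff_dist (?S k) A < e \<and> 1 \<le> k"
    by (intro eventually_conj order_tendstoD(2)[OF lim e(1)] eventually_ge_at_top)
  then obtain k where k: "hausdorff_dist (?S k) A < e" "1 \<le> k"
    using eventually_happens'[OF sequentially_bot] by blast
  have "a \<in> A"
    using e centre_in_ball by blast
  \<comment> \<open>The half of the Hausdorff distance that matters here is the one saying that each
    point of \<open>A\<close> is near the orbit set.\<close>
  have "infdist a (?S k) < e"
    by (rule le_less_trans[OF infdist_le_hausdorff_dist[OF assms(2) \<open>a \<in> A\<close>] k(1)])
  moreover have ne: "?S k \<noteq> {}"
    by (rule hutchinson_funpow_nonempty[OF assms(1)]) simp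
  \<comment> \<open>On the empty set \<open>infdist\<close> defaults to 0, so nonemptiness is what
    turns smallness into an actual nearby point.\<close>
  ultimately have "(INF y\<in>?S k. dist a y) < e"
    by (simp only: infdist_notempty[OF ne])
  then obtain y where "y \<in> ?S k" "dist a y < e"
    unfolding cINF_less_iff[OF ne bdd_below_image_dist] by blast
  then have "?S k \<inter> A \<noteq> {}"
    using e(2) mem_ball by blast
  then show "x \<in> fast_basin N f A"
    unfolding fast_basin_def using k(2) by blast
qed

text \<open>Partners \<open>x\<close>, \<open>y\<close> are followed through the same map
  \<open>f n\<close>, gaining a factor \<open>r\<close> each time. The one-sided form can be used in
  both directions between two sets.\<close>

lemma hutchinson_funpow_close:
  assumes "\<forall>n\<in>{1..N}. \<forall>x y. dist (f n x) (f n y) \<le> r * dist x y" "0 \<le> r"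
    and "\<forall>x\<in>S. \<exists>y\<in>T. dist x y \<le> e"
  shows "\<forall>x\<in>(hutchinson N f ^^ k) S. \<exists>y\<in>(hutchinson N f ^^ k) T. dist x y \<le> r ^ k * e"
proof (induction k)
  case (Suc k)
  show ?case
  proof
    fix x' assume "x' \<in> (hutchinson N f ^^ Suc k) S"
    then obtain n x where x: "n \<in> {1..N}" "x \<in> (hutchinson N f ^^ k) S" "x' = f n x"
      by (auto simp: hutchinson_def)
    then obtain y where y: "y \<in> (hutchinson N f ^^ k) T" "dist x y \<le> r ^ k * e"
      using Suc by blast
    have "dist x' (f n y) \<le> r * dist x y"
      using assms(1) x by blast
    also have "\<dots> \<le> r ^ Suc k * e"
      using mult_left_mono[OF y(2) assms(2)] by (simp add: mult.assoc)
    finally show "\<exists>y\<in>(hutchinson N f ^^ Suc k) T. dist x' y \<le> r ^ Suc k * e"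
      using x(1) y(1) by (auto simp: hutchinson_def)
  qed
qed (use assms(3) in simp)

lemma contractive_basin_eq_UNIV:
  assumes "1 \<le> N" "contractive N f" "A \<in> hyperspace" "hutchinson N f A = A"
  shows "basin N f A = UNIV"
proof -
  obtain r where r: "0 \<le> r" "r < 1" "\<forall>n\<in>{1..N}. \<forall>x y. dist (f n x) (f n y) \<le> r * dist x y"
    using assms(2) unfolding contractive_def by blast
  have A: "compact A" "A \<noteq> {}"
    using assms(3) by (auto simp: hyperspace_def)
  have fixed: "(hutchinson N f ^^ k) A = A" for k
    by (induction k) (simp_all add: assms(4))
  have "hausdorff_tendsto (\<lambda>k. (hutchinson N f ^^ k) C) A" if "C \<in> hyperspace" for C
  proof -
    let ?S = "\<lambda>k. (hutchinson N f ^^ k) C"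
    have C: "compact C" "C \<noteq> {}"
      using that by (auto simp: hyperspace_def)
    \<comment> \<open>A bound \<open>e\<close> on the diameter of \<open>C \<union> A\<close> serves
      as the initial distance for both directions.\<close>
    have "bounded (C \<union> A)"
      using A C by (simp add: compact_imp_bounded)
    then obtain e where e: "\<And>x y. x \<in> C \<union> A \<Longrightarrow> y \<in> C \<union> A \<Longrightarrow> dist x y \<le> e"
      unfolding bounded_two_points by blast
    have "\<forall>x\<in>C. \<exists>y\<in>A. dist x y \<le> e" "\<forall>y\<in>A. \<exists>x\<in>C. dist y x \<le> e"
      using e A(2) C(2) by (meson UnI1 UnI2 ex_in_conv)+
    from this[THEN hutchinson_funpow_close[OF r(3,1)]]
    have upper: "hausdorff_dist (?S k) A \<le> r ^ k * e" for k
      unfolding fixed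
      by (rule hausdorff_dist_le[OF hutchinson_funpow_nonempty[OF assms(1) C(2)] A(2)])
    obtain a where a: "a \<in> A"
      using A(2) by blast
    \<comment> \<open>Nonnegativity is not built into \<open>hausdorff_dist\<close>; it is inherited
      from \<open>infdist\<close> at any point of \<open>A\<close>.\<close>
    have lower: "0 \<le> hausdorff_dist (?S k) A" for k
      by (rule order_trans[OF infdist_nonneg infdist_le_hausdorff_dist[OF A(1) a]])
    have "(\<lambda>k. r ^ k * e) \<longlonglongrightarrow> 0"
      using r(1,2) by (intro tendsto_mult_left_zero LIMSEQ_power_zero) simp
    then show ?thesis
      unfolding hausdorff_tendsto_def
      by (rule tendsto_sandwich[OF always_eventually[OF allI[OF lower]]
            always_eventually[OF allI[OF upper]] tendsto_const])
  qed
  then have "attracting_nbhd N f A UNIV"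
    by (simp add: attracting_nbhd_def)
  then show ?thesis
    by (auto simp: basin_def)
qed

theorem corollary4p6:
  fixes N :: nat and f :: "nat \<Rightarrow> 'a::complete_space \<Rightarrow> 'a" and A :: "'a set"
  assumes "IFS N f" and "attractor N f A" and "point_fibred N f A"
  shows "(basin N f A \<subseteq> fast_basin N f A \<longleftrightarrow> interior A \<noteq> {}) \<and>
    (contractive N f \<and> interior A \<noteq> {} \<longrightarrow>
      basin N f A = UNIV \<and> fast_basin N f A = UNIV)"
proof -
  have N: "1 \<le> N"
    using assms(1) by (simp add: IFS_def)
  have A: "A \<in> hyperspace" "hutchinson N f A = A"
    using assms(2) by (auto simp: attractor_def)
  then have "compact A"
    by (simp add: hyperspace_def)
  then have "basin N f A \<subseteq> fast_basin N f A \<longleftrightarrow> interior A \<noteq> {}"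
    using interior_nonempty_if_basin_subset_fast_basin[OF assms(1,2)]
      basin_subset_fast_basin[OF N] by blast
  moreover have "contractive N f \<Longrightarrow> basin N f A = UNIV"
    by (rule contractive_basin_eq_UNIV[OF N _ A])
  \<comment> \<open>When \<open>A\<close> has interior, the equivalence puts the basin, here the
    whole space, inside the fast basin.\<close>
  ultimately show ?thesis
    by auto
qed

end
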